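(* There is a one-sided non-adaptive algorithm which, if it is given $N:=|f^{-1}(1)|$ (together with $n$, $\varepsilon$, and access to $\mathrm{MQ}(f)$ and $\mathrm{Samp}(f)$ for an unknown $f:\{0,1\}^n\to\{0,1\}$), is an $\varepsilon$-relative-error tester for monotonicity making $O(\log(N)/\varepsilon)$ calls to $\mathrm{Samp}(f)$ and $\mathrm{MQ}(f)$.
   Context: $\mathrm{rel\text{-}dist}(f,g)=|f^{-1}(1)\triangle g^{-1}(1)|/|f^{-1}(1)|$; relative distance to the class of monotone functions is the minimum over monotone $g$. $\mathrm{MQ}(f)$ returns $f(x)$ on query $x$; $\mathrm{Samp}(f)$ returns an independent uniform element of $f^{-1}(1)$. An $\varepsilon$-relative-error tester for monotonicity accepts monotone $f$ with probability at least $2/3$ and rejects $f$ with relative distance greater than $\varepsilon$ from monotone with probability at least $2/3$; one-sided means monotone $f$ are accepted with probability $1$. Non-adaptive means that after receiving all $\mathrm{Samp}(f)$ responses, all $\mathrm{MQ}(f)$ queries are made in one parallel round. $f$ is monotone if $x\preceq y$ coordinatewise implies $f(x)\le f(y)$. *)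

theory Defs
  imports "HOL-Probability.Probability_Mass_Function"
begin

type_synonym point = "bool list"

definition cube :: "nat \<Rightarrow> point set" where
  "cube n = {x. length x = n}"

(* A function {0,1}^n \<rightarrow> {0,1} is represented by f :: point \<Rightarrow> bool; only its values on
   cube n matter. *)

definition ones :: "nat \<Rightarrow> (point \<Rightarrow> bool) \<Rightarrow> point set" where
  "ones n f = {x \<in> cube n. f x}"

definition monotone_bf :: "nat \<Rightarrow> (point \<Rightarrow> bool) \<Rightarrow> bool" where
  "monotone_bf n f \<longleftrightarrow> monotone_on (cube n) (list_all2 (\<le>)) (\<le>) f"

definition rel_dist :: "nat \<Rightarrow> (point \<Rightarrow> bool) \<Rightarrow> (point \<Rightarrow> bool) \<Rightarrow> real" where
  "rel_dist n f g = real (card (sym_diff (ones n f) (ones n g))) / real (card (ones n f))"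

(* The set below is finite and nonempty: every value is k / card (ones n f) with
   k \<le> 2 ^ n, and constant functions are monotone. *)
definition rel_dist_monotone :: "nat \<Rightarrow> (point \<Rightarrow> bool) \<Rightarrow> real" where
  "rel_dist_monotone n f = Min {rel_dist n f g | g. monotone_bf n g}"

(* Samp(f); meaningful only if f is not identically 0 on the cube. *)
definition samp :: "nat \<Rightarrow> (point \<Rightarrow> bool) \<Rightarrow> point pmf" where
  "samp n f = pmf_of_set (ones n f)"

(* A non-adaptive randomized algorithm draws num_samples samples, and from their list
   it computes, using internal randomness, the list of all its membership queries together
   with a rule mapping the list of answers to a verdict (True = accept). Any randomness of
   the final decision is absorbed into the joint distribution of queries and rule. *)
record nonadaptive_alg =
  num_samples :: nat
  plan :: "point list \<Rightarrow> (point list \<times> (bool list \<Rightarrow> bool)) pmf"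

definition queries_in_cube :: "nat \<Rightarrow> nonadaptive_alg \<Rightarrow> bool" where
  "queries_in_cube n A \<longleftrightarrow>
     (\<forall>xs. length xs = num_samples A \<and> set xs \<subseteq> cube n \<longrightarrow>
        (\<forall>(qs, d) \<in> set_pmf (plan A xs). set qs \<subseteq> cube n))"

(* Joint distribution of the verdict and the number of oracle calls. *)
definition run :: "nat \<Rightarrow> nonadaptive_alg \<Rightarrow> (point \<Rightarrow> bool) \<Rightarrow> (bool \<times> nat) pmf" where
  "run n A f =
     do {
       xs \<leftarrow> replicate_pmf (num_samples A) (samp n f);
       (qs, d) \<leftarrow> plan A xs;
       return_pmf (d (map f qs), num_samples A + length qs)
     }"

definition accept_prob :: "nat \<Rightarrow> nonadaptive_alg \<Rightarrow> (point \<Rightarrow> bool) \<Rightarrow> real" where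
  "accept_prob n A f = measure_pmf.prob (run n A f) {(b, k). b}"

definition reject_prob :: "nat \<Rightarrow> nonadaptive_alg \<Rightarrow> (point \<Rightarrow> bool) \<Rightarrow> real" where
  "reject_prob n A f = measure_pmf.prob (run n A f) {(b, k). \<not> b}"

(* The next three notions concern inputs promised to have exactly N satisfying points. *)

definition monotonicity_tester :: "nat \<Rightarrow> nat \<Rightarrow> real \<Rightarrow> nonadaptive_alg \<Rightarrow> bool" where
  "monotonicity_tester n N \<epsilon> A \<longleftrightarrow>
     (\<forall>f. card (ones n f) = N \<longrightarrow>
        (monotone_bf n f \<longrightarrow> accept_prob n A f \<ge> 2 / 3) \<and>
        (rel_dist_monotone n f > \<epsilon> \<longrightarrow> reject_prob n A f \<ge> 2 / 3))"

definition one_sided :: "nat \<Rightarrow> nat \<Rightarrow> nonadaptive_alg \<Rightarrow> bool" where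
  "one_sided n N A \<longleftrightarrow>
     (\<forall>f. card (ones n f) = N \<and> monotone_bf n f \<longrightarrow> accept_prob n A f = 1)"

definition calls_at_most :: "nat \<Rightarrow> nat \<Rightarrow> nonadaptive_alg \<Rightarrow> real \<Rightarrow> bool" where
  "calls_at_most n N A B \<longleftrightarrow>
     (\<forall>f. card (ones n f) = N \<longrightarrow> (\<forall>(b, k) \<in> set_pmf (run n A f). real k \<le> B))"

end

theory Submission
  imports Defs
begin

text \<open>
  If \<open>f\<close> is monotone, every point \<open>x\<close> with \<open>f x\<close> has at most \<open>log\<^sub>2 N\<close> zero coordinates, because the
  whole upper cube of \<open>x\<close> lies in \<open>f\<^sup>-\<^sup>1(1)\<close>. The tester draws \<open>O(log N / \<epsilon>)\<close> samples, queries one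
  uniformly random upper neighbour of each, and rejects on a sample with too many zeros or on a
  violated edge. For soundness, first delete from \<open>f\<close> the points with too many zeros (this creates no
  violation above the remaining points), and then sort the values along the coordinates one after
  the other: sorting one coordinate does not increase the number of violated edges in the others,
  so the distance to monotonicity is at most twice the number of violated edges. Since a remaining
  point has at most \<open>log\<^sub>2 N\<close> upper neighbours, one sample exposes a defect with probability
  \<open>\<Omega>(\<epsilon> / log N)\<close>.
\<close>

section \<open>Distance to monotonicity and violated edges\<close>

lemma cube_0: "cube 0 = {[]}"
  by (auto simp: cube_def)

lemma cube_Suc: "cube (Suc n) = (#) False ` cube n \<union> (#) True ` cube n"
  by (auto simp: cube_def length_Suc_conv image_iff)

lemma finite_cube: "finite (cube n)"
  by (induction n) (auto simp: cube_0 cube_Suc)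

lemma sum_cube_Suc:
  "sum h (cube (Suc n)) = (\<Sum>x\<in>cube n. h (False # x)) + (\<Sum>x\<in>cube n. h (True # x))"
proof -
  have "sum h (cube (Suc n)) = sum h ((#) False ` cube n) + sum h ((#) True ` cube n)"
    unfolding cube_Suc by (rule sum.union_disjoint) (auto simp: finite_cube)
  then show ?thesis
    by (simp add: sum.reindex inj_on_def)
qed

definition zeros :: "point \<Rightarrow> nat set" where
  "zeros x = {i. i < length x \<and> \<not> x ! i}"

definition violations :: "(point \<Rightarrow> bool) \<Rightarrow> point \<Rightarrow> nat" where
  "violations f x = (\<Sum>i<length x. of_bool (f x \<and> \<not> x ! i \<and> \<not> f (x[i := True])))"

definition num_diff :: "nat \<Rightarrow> (point \<Rightarrow> bool) \<Rightarrow> (point \<Rightarrow> bool) \<Rightarrow> nat" where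
  "num_diff n f g = (\<Sum>x\<in>cube n. of_bool (f x \<noteq> g x))"

lemma num_diff_triangle: "num_diff n f h \<le> num_diff n f g + num_diff n g h"
  unfolding num_diff_def sum.distrib[symmetric] by (rule sum_mono) auto

lemma num_diff_Suc:
  "num_diff (Suc n) f g =
     num_diff n (\<lambda>x. f (False # x)) (\<lambda>x. g (False # x)) +
     num_diff n (\<lambda>x. f (True # x)) (\<lambda>x. g (True # x))"
  by (simp add: num_diff_def sum_cube_Suc)

lemma violations_Cons:
  "violations f (b # x) =
     of_bool (f (b # x) \<and> \<not> b \<and> \<not> f (True # x)) + violations (\<lambda>y. f (b # y)) x"
  by (simp add: violations_def sum.lessThan_Suc_shift del: sum.lessThan_Suc)

lemma sum_violations_Suc:
  "(\<Sum>x\<in>cube (Suc n). violations f x) =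
     (\<Sum>x\<in>cube n. of_bool (f (False # x) \<and> \<not> f (True # x))) +
     (\<Sum>x\<in>cube n. violations (\<lambda>y. f (False # y)) x) +
     (\<Sum>x\<in>cube n. violations (\<lambda>y. f (True # y)) x)"
  by (simp add: sum_cube_Suc violations_Cons sum.distrib)

text \<open>This holds edge by edge. If \<open>f\<close> and \<open>g\<close> together have s ones
  at the lower end and t at the upper end, meet and join have exactly max(0, s - t) violations
  there, the fewest possible for these counts.\<close>

lemma violations_conj_disj:
  "violations (\<lambda>y. f y \<and> g y) x + violations (\<lambda>y. f y \<or> g y) x \<le>
     violations f x + violations g x"
  unfolding violations_def sum.distrib[symmetric] by (rule sum_mono) auto

section \<open>Sorting along the coordinates, first coordinate first\<close>

primrec monotonize :: "nat \<Rightarrow> (point \<Rightarrow> bool) \<Rightarrow> point \<Rightarrow> bool" where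
  "monotonize 0 f = f"
| "monotonize (Suc n) f = (\<lambda>x.
     if hd x then monotonize n (\<lambda>y. f (False # y) \<or> f (True # y)) (tl x)
     else monotonize n (\<lambda>y. f (False # y) \<and> f (True # y)) (tl x))"

lemma monotonize_mono:
  assumes "\<And>x. f x \<Longrightarrow> g x" and "monotonize n f x"
  shows "monotonize n g x"
  using assms
proof (induction n arbitrary: f g x)
  case (Suc n)
  show ?case
  proof (cases "hd x")
    case True
    show ?thesis
      using Suc.IH[of "\<lambda>y. f (False # y) \<or> f (True # y)" "\<lambda>y. g (False # y) \<or> g (True # y)" "tl x"]
        Suc.prems True by auto
  next
    case False
    show ?thesis
      using Suc.IH[of "\<lambda>y. f (False # y) \<and> f (True # y)" "\<lambda>y. g (False # y) \<and> g (True # y)" "tl x"]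
        Suc.prems False by auto
  qed
qed auto

lemma monotone_bf_iff:
  "monotone_bf n f \<longleftrightarrow> (\<forall>x y. length x = n \<longrightarrow> list_all2 (\<le>) x y \<longrightarrow> f x \<longrightarrow> f y)"
  unfolding monotone_bf_def monotone_on_def cube_def
  by (simp add: le_bool_def) (metis list_all2_lengthD)

text \<open>Within one half of the cube, induction applies. Between the halves, the lower one comes
  from the meet and the upper one from the join, so \<open>monotonize_mono\<close> orders
  them.\<close>

lemma monotone_monotonize: "monotone_bf n (monotonize n f)"
proof (induction n arbitrary: f)
  case (Suc n)
  show ?case
    unfolding monotone_bf_iff
  proof (intro allI impI)
    fix x y assume *: "length x = Suc n" "list_all2 (\<le>) x y" "monotonize (Suc n) f x"
    obtain a u where x: "x = a # u" "length u = n"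
      using *(1) by (auto simp: length_Suc_conv)
    obtain b v where y: "y = b # v" "a \<le> b" "list_all2 (\<le>) u v"
      using *(2) x by (auto simp: list_all2_Cons1)
    have step: "monotonize n h u \<Longrightarrow> monotonize n h v" for h
      using Suc.IH[of h] x y by (auto simp: monotone_bf_iff)
    have up: "monotonize n (\<lambda>y. f (False # y) \<and> f (True # y)) v \<Longrightarrow>
        monotonize n (\<lambda>y. f (False # y) \<or> f (True # y)) v"
      by (erule monotonize_mono[rotated]) auto
    show "monotonize (Suc n) f y"
      using *(3) x y step up by (auto split: if_splits)
  qed
qed (auto simp: monotone_bf_iff)

text \<open>The first sorting is paid for by the violated edges in its direction. The two recursive
  calls are paid for by the violations of \<open>lo\<close> and \<open>hi\<close>, which together
  are no more than those of the original halves.\<close>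

lemma num_diff_monotonize:
  "num_diff n f (monotonize n f) \<le> 2 * (\<Sum>x\<in>cube n. violations f x)"
proof (induction n arbitrary: f)
  case 0
  show ?case by (simp add: num_diff_def)
next
  case (Suc n)
  define f0 where "f0 = (\<lambda>x. f (False # x))"
  define f1 where "f1 = (\<lambda>x. f (True # x))"
  define lo where "lo = (\<lambda>x. f0 x \<and> f1 x)"
  define hi where "hi = (\<lambda>x. f0 x \<or> f1 x)"
  let ?e = "\<Sum>x\<in>cube n. of_bool (f0 x \<and> \<not> f1 x) :: nat"
  \<comment> \<open>Sorting swaps the values at both ends of every violated edge and changes nothing
    else; this is the source of the factor 2.\<close>
  have "num_diff n f0 lo = ?e" "num_diff n f1 hi = ?e"
    unfolding num_diff_def lo_def hi_def by (auto intro!: sum.cong)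
  moreover have "num_diff (Suc n) f (monotonize (Suc n) f) =
      num_diff n f0 (monotonize n lo) + num_diff n f1 (monotonize n hi)"
    by (simp add: num_diff_Suc f0_def f1_def lo_def hi_def)
  moreover have "(\<Sum>x\<in>cube n. violations lo x) + (\<Sum>x\<in>cube n. violations hi x) \<le>
      (\<Sum>x\<in>cube n. violations f0 x) + (\<Sum>x\<in>cube n. violations f1 x)"
    unfolding lo_def hi_def sum.distrib[symmetric]
    by (rule sum_mono) (rule violations_conj_disj)
  moreover have "(\<Sum>x\<in>cube (Suc n). violations f x) =
      ?e + (\<Sum>x\<in>cube n. violations f0 x) + (\<Sum>x\<in>cube n. violations f1 x)"
    unfolding f0_def f1_def by (rule sum_violations_Suc)
  ultimately show ?case
    using num_diff_triangle[of n f0 "monotonize n lo" lo]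
      num_diff_triangle[of n f1 "monotonize n hi" hi] Suc.IH[of lo] Suc.IH[of hi]
    by linarith
qed

section \<open>Relative distance as a count of changed points\<close>

lemma finite_ones: "finite (ones n f)"
  by (simp add: ones_def finite_cube)

lemma card_sym_diff_ones: "card (sym_diff (ones n f) (ones n g)) = num_diff n f g"
proof -
  have "sym_diff (ones n f) (ones n g) = cube n \<inter> {x. f x \<noteq> g x}"
    by (auto simp: ones_def)
  then show ?thesis
    by (simp add: num_diff_def finite_cube)
qed

lemma rel_dist_monotone_le:
  assumes "monotone_bf n g"
  shows "rel_dist_monotone n f \<le> rel_dist n f g"
  unfolding rel_dist_monotone_def
proof (rule Min_le)
  \<comment> \<open>\<open>Min\<close> needs a finite set. There are infinitely many
    \<open>g\<close>, but all distances share one denominator and have bounded numerators.\<close>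
  have "card (sym_diff (ones n f) (ones n h)) \<le> card (cube n)" for h
    by (rule card_mono) (auto simp: finite_cube ones_def)
  then have "{rel_dist n f g | g. monotone_bf n g} \<subseteq>
      (\<lambda>k. real k / real (card (ones n f))) ` {..card (cube n)}"
    by (auto simp: rel_dist_def)
  then show "finite {rel_dist n f g | g. monotone_bf n g}"
    by (rule finite_subset) simp
qed (use assms in auto)

text \<open>The constant \<open>False\<close> differs from \<open>f\<close> exactly on
  \<open>ones n f\<close>; if that set is empty, the quotient is 0 by convention. In the soundness
  proof this forces \<open>\<epsilon> < 1\<close>.\<close>

lemma rel_dist_monotone_le_1: "rel_dist_monotone n f \<le> 1"
proof -
  have "rel_dist n f (\<lambda>_. False) \<le> 1"
    by (simp add: rel_dist_def ones_def)
  moreover have "monotone_bf n (\<lambda>_. False)"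
    by (simp add: monotone_bf_iff)
  ultimately show ?thesis
    using rel_dist_monotone_le[of n "\<lambda>_. False" f] by linarith
qed

section \<open>Zero coordinates, upper cubes and deletion of points\<close>

lemma finite_zeros: "finite (zeros x)"
  by (simp add: zeros_def)

lemma card_zeros: "card (zeros x) = length (filter Not x)"
  by (simp add: zeros_def length_filter_conv_card)

lemma card_upper_set: "card {y. list_all2 (\<le>) x y} = 2 ^ card (zeros x)"
proof (induction x)
  case (Cons b x)
  define U where "U = {y. list_all2 (\<le>) x y}"
  have IH: "card U = 2 ^ card (zeros x)"
    unfolding U_def by (rule Cons.IH)
  have fin: "finite U"
    unfolding U_def by (rule finite_subset[OF _ finite_cube[of "length x"]])
      (auto simp: cube_def dest: list_all2_lengthD)
  have zeros: "card (zeros (b # x)) = of_bool (\<not> b) + card (zeros x)"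
    by (simp add: card_zeros)
  show ?case
  proof (cases b)
    case True
    then have eq: "{y. list_all2 (\<le>) (b # x) y} = (#) True ` U"
      by (auto simp: U_def list_all2_Cons1)
    show ?thesis
      unfolding eq using IH zeros True by (simp add: card_image)
  next
    case False
    then have eq: "{y. list_all2 (\<le>) (b # x) y} = (#) False ` U \<union> (#) True ` U"
      by (auto simp: U_def list_all2_Cons1 image_iff)
    have "card ((#) False ` U \<union> (#) True ` U) = card U + card U"
      by (subst card_Un_disjoint) (auto simp: fin card_image)
    then show ?thesis
      unfolding eq using IH zeros False by simp
  qed
qed (auto simp: zeros_def)

lemma zeros_bound_of_monotone:
  assumes "monotone_bf n f" and "x \<in> ones n f"
  shows "2 ^ card (zeros x) \<le> card (ones n f)"
proof -
  have "{y. list_all2 (\<le>) x y} \<subseteq> ones n f"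
    using assms by (auto simp: monotone_bf_iff ones_def cube_def dest: list_all2_lengthD)
  then show ?thesis
    using card_mono[OF finite_ones] by (metis card_upper_set)
qed

lemma list_all2_le_update: "list_all2 (\<le>) x (x[i := True])"
  by (cases "i < length x") (auto simp: list_all2_conv_all_nth nth_list_update list_update_beyond)

lemma zeros_update_subset: "zeros (x[i := True]) \<subseteq> zeros x"
  by (cases "i < length x") (auto simp: zeros_def nth_list_update list_update_beyond split: if_splits)

text \<open>Raising a coordinate preserves \<open>P\<close>, so no upper neighbour of a kept point
  is deleted: kept points gain no violations, and deleted points have none.\<close>

lemma violations_restrict:
  assumes "\<And>x i. P x \<Longrightarrow> P (x[i := True])"
  shows "violations (\<lambda>y. f y \<and> P y) x = (if f x \<and> P x then violations f x else 0)"
  using assms by (auto simp: violations_def intro!: sum.cong)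

lemma violations_eq_card:
  assumes "f x"
  shows "violations f x = card {i \<in> zeros x. \<not> f (x[i := True])}"
proof -
  have "{i \<in> zeros x. \<not> f (x[i := True])} =
      {..<length x} \<inter> {i. \<not> x ! i \<and> \<not> f (x[i := True])}"
    by (auto simp: zeros_def)
  then show ?thesis
    using assms by (simp add: violations_def)
qed

text \<open>The right side is the cost of a repair: 1 for deleting a point outside \<open>P\<close>,
  and 2 per violated edge for sorting what remains.\<close>

lemma rel_dist_bound_by_violations:
  assumes "rel_dist_monotone n f > \<epsilon>" and "ones n f \<noteq> {}"
    and up: "\<And>x i. P x \<Longrightarrow> P (x[i := True])"
  shows "\<epsilon> * card (ones n f) \<le>
    (\<Sum>x\<in>ones n f. if P x then 2 * real (violations f x) else 1)"
proof -
  let ?g = "\<lambda>x. f x \<and> P x"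
  have "num_diff n f (monotonize n ?g) \<le> num_diff n f ?g + 2 * (\<Sum>x\<in>cube n. violations ?g x)"
    using num_diff_triangle[of n f "monotonize n ?g" ?g] num_diff_monotonize[of n ?g] by linarith
  also have "\<dots> = (\<Sum>x\<in>cube n. of_bool (f x \<and> \<not> P x) + 2 * violations ?g x)"
    by (auto simp: num_diff_def sum.distrib sum_distrib_left intro!: sum.cong)
  also have "\<dots> = (\<Sum>x\<in>cube n. if f x then if P x then 2 * violations f x else 1 else 0)"
    by (intro sum.cong refl) (simp add: violations_restrict[where P = P, OF up])
  also have "\<dots> = (\<Sum>x\<in>ones n f. if P x then 2 * violations f x else 1)"
    unfolding ones_def by (rule sum.inter_filter[symmetric]) (rule finite_cube)
  finally have "real (num_diff n f (monotonize n ?g)) \<le>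
      (\<Sum>x\<in>ones n f. if P x then 2 * real (violations f x) else 1)"
    by (subst (asm) of_nat_le_iff[where 'a = real, symmetric]) (simp add: if_distrib cong: if_cong)
  moreover have "\<epsilon> < rel_dist n f (monotonize n ?g)"
    using assms(1) rel_dist_monotone_le[OF monotone_monotonize] by (rule less_le_trans)
  then have "\<epsilon> * card (ones n f) < num_diff n f (monotonize n ?g)"
    using assms(2) by (simp add: rel_dist_def card_sym_diff_ones pos_less_divide_eq card_gt_0_iff finite_ones)
  ultimately show ?thesis
    by linarith
qed

section \<open>The tester\<close>

primrec bind_each :: "('a \<Rightarrow> 'b pmf) \<Rightarrow> 'a list \<Rightarrow> 'b list pmf" where
  "bind_each q [] = return_pmf []"
| "bind_each q (x # xs) = do { y \<leftarrow> q x; ys \<leftarrow> bind_each q xs; return_pmf (y # ys) }"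

lemma set_bind_each: "set_pmf (bind_each q xs) = {ys. list_all2 (\<lambda>x y. y \<in> set_pmf (q x)) xs ys}"
  by (induction xs) (auto simp: list_all2_Cons1)

lemma pmf_conj_True:
  "pmf (do { b \<leftarrow> A; c \<leftarrow> B; return_pmf (b \<and> c) }) True = pmf A True * pmf B True"
proof -
  have "do { b \<leftarrow> A; c \<leftarrow> B; return_pmf (b \<and> c) } = map_pmf (\<lambda>(b, c). b \<and> c) (pair_pmf A B)"
    by (simp add: pair_pmf_def map_bind_pmf)
  moreover have "(\<lambda>(b, c). b \<and> c) -` {True} = {(True, True)}"
    by auto
  ultimately show ?thesis
    by (simp add: pmf_map measure_pmf_single pmf_pair)
qed

text \<open>A non-adaptive run draws all samples before choosing any query. Each query depends only
  on its own sample, so the run is equivalent to \<open>m\<close> independent rounds.\<close>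

lemma pmf_all_rounds:
  "pmf (do { xs \<leftarrow> replicate_pmf m p; ys \<leftarrow> bind_each q xs;
             return_pmf ((\<forall>x\<in>set xs. P x) \<and> (\<forall>y\<in>set ys. Q y)) }) True =
   pmf (do { x \<leftarrow> p; y \<leftarrow> q x; return_pmf (P x \<and> Q y) }) True ^ m"
  (is "pmf (?T m) True = pmf ?R True ^ m")
proof (induction m)
  case (Suc m)
  have "?T (Suc m) = do { x \<leftarrow> p; xs \<leftarrow> replicate_pmf m p; y \<leftarrow> q x; ys \<leftarrow> bind_each q xs;
      return_pmf ((P x \<and> Q y) \<and> ((\<forall>x\<in>set xs. P x) \<and> (\<forall>y\<in>set ys. Q y))) }"
    by (simp add: bind_assoc_pmf bind_return_pmf conj_ac)
  \<comment> \<open>The query for the first sample is moved ahead of the remaining samples, from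
    which it is independent.\<close>
  also have "\<dots> = do { x \<leftarrow> p; y \<leftarrow> q x; xs \<leftarrow> replicate_pmf m p; ys \<leftarrow> bind_each q xs;
      return_pmf ((P x \<and> Q y) \<and> ((\<forall>x\<in>set xs. P x) \<and> (\<forall>y\<in>set ys. Q y))) }"
    by (subst bind_commute_pmf[of "replicate_pmf m p"]) simp
  also have "\<dots> = do { b \<leftarrow> ?R; c \<leftarrow> ?T m; return_pmf (b \<and> c) }"
    by (simp add: bind_assoc_pmf bind_return_pmf)
  finally show ?case
    by (simp only: pmf_conj_True Suc.IH power_Suc)
qed (simp add: bind_return_pmf)

text \<open>The index \<open>length x\<close> leaves \<open>x\<close> unchanged; it keeps the set of choices nonempty when \<open>x\<close> has
  no upper neighbour.\<close>
definition up_neighbour :: "point \<Rightarrow> point pmf" where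
  "up_neighbour x = map_pmf (\<lambda>i. x[i := True]) (pmf_of_set (insert (length x) (zeros x)))"

text \<open>The test \<open>2 ^ card (zeros x) \<le> N\<close> is the integer form of the
  logarithmic bound. Rounding down keeps the call bound valid for every positive
  \<open>\<epsilon>\<close>; the constant 9 leaves room for the loss.\<close>

definition edge_tester :: "nat \<Rightarrow> real \<Rightarrow> nonadaptive_alg" where
  "edge_tester N \<epsilon> = \<lparr>
     num_samples = nat \<lfloor>9 * max 1 (log 2 N) / \<epsilon>\<rfloor>,
     plan = (\<lambda>xs. map_pmf
       (\<lambda>qs. (qs, \<lambda>as. (\<forall>x\<in>set xs. 2 ^ card (zeros x) \<le> N) \<and> (\<forall>a\<in>set as. a)))
       (bind_each up_neighbour xs)) \<rparr>"

lemma set_up_neighbour: "set_pmf (up_neighbour x) = (\<lambda>i. x[i := True]) ` insert (length x) (zeros x)"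
  by (simp add: up_neighbour_def set_pmf_of_set finite_zeros)

lemma run_edge_tester:
  "run n (edge_tester N \<epsilon>) f =
     do { xs \<leftarrow> replicate_pmf (num_samples (edge_tester N \<epsilon>)) (samp n f);
          qs \<leftarrow> bind_each up_neighbour xs;
          return_pmf ((\<forall>x\<in>set xs. 2 ^ card (zeros x) \<le> N) \<and> (\<forall>q\<in>set qs. f q),
                      num_samples (edge_tester N \<epsilon>) + length qs) }"
  by (simp add: run_def edge_tester_def bind_map_pmf)

lemma accept_prob_edge_tester:
  "accept_prob n (edge_tester N \<epsilon>) f =
     pmf (do { x \<leftarrow> samp n f; y \<leftarrow> up_neighbour x;
               return_pmf (2 ^ card (zeros x) \<le> N \<and> f y) }) True
       ^ num_samples (edge_tester N \<epsilon>)"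
proof -
  have "{(b :: bool, k :: nat). b} = fst -` {True}"
    by (auto simp: vimage_def)
  then have "accept_prob n (edge_tester N \<epsilon>) f = pmf (map_pmf fst (run n (edge_tester N \<epsilon>) f)) True"
    by (simp add: accept_prob_def pmf_map)
  then show ?thesis
    by (simp add: run_edge_tester map_bind_pmf pmf_all_rounds)
qed

lemma reject_prob_eq: "reject_prob n A f = 1 - accept_prob n A f"
proof -
  have "{(b :: bool, k :: nat). \<not> b} = space (measure_pmf (run n A f)) - {(b, k). b}"
    by auto
  then show ?thesis
    unfolding reject_prob_def accept_prob_def
    by (metis measure_pmf.prob_compl sets_measure_pmf UNIV_I sets_UNIV)
qed

section \<open>Completeness with one-sided error\<close>

lemma edge_tester_complete:
  assumes "monotone_bf n f" and "card (ones n f) = N" and "N \<ge> 1"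
  shows "accept_prob n (edge_tester N \<epsilon>) f = 1"
proof -
  let ?R = "do { x \<leftarrow> samp n f; y \<leftarrow> up_neighbour x; return_pmf (2 ^ card (zeros x) \<le> N \<and> f y) }"
  have "ones n f \<noteq> {}"
    using assms by auto
  then have samp: "set_pmf (samp n f) = ones n f"
    by (simp add: samp_def set_pmf_of_set finite_ones)
  have "f (x[i := True])" if "x \<in> ones n f" for x i
    using assms(1) that list_all2_le_update[of x i]
    by (auto simp: monotone_bf_iff ones_def cube_def)
  then have "set_pmf ?R \<subseteq> {True}"
    using zeros_bound_of_monotone[OF assms(1)] assms(2) by (auto simp: samp set_up_neighbour)
  then have "?R = return_pmf True"
    by (rule set_pmf_subset_singleton[THEN iffD1])
  then show ?thesis
    by (simp add: accept_prob_edge_tester)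
qed

section \<open>Soundness\<close>

lemma up_neighbour_defect:
  assumes "f x"
  shows "pmf (do { y \<leftarrow> up_neighbour x; return_pmf (c \<and> f y) }) False =
    (if c then violations f x / (card (zeros x) + 1) else 1)"
proof (cases c)
  case True
  \<comment> \<open>The extra index yields \<open>x\<close> itself, where \<open>f\<close> is true,
    so it exposes nothing and only adds 1 to the denominator.\<close>
  have "insert (length x) (zeros x) \<inter> (\<lambda>i. f (x[i := True])) -` {False} =
      {i \<in> zeros x. \<not> f (x[i := True])}"
    using assms by (auto simp: list_update_beyond)
  moreover have "card (insert (length x) (zeros x)) = card (zeros x) + 1"
    by (subst card_insert_disjoint) (auto simp: finite_zeros zeros_def)
  moreover have "do { y \<leftarrow> up_neighbour x; return_pmf (c \<and> f y) } =
      map_pmf (\<lambda>i. f (x[i := True])) (pmf_of_set (insert (length x) (zeros x)))"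
    using True by (simp add: up_neighbour_def bind_map_pmf) (simp add: map_pmf_def)
  ultimately show ?thesis
    using True assms by (simp add: pmf_map measure_pmf_of_set finite_zeros violations_eq_card)
qed simp

lemma round_defect:
  assumes "rel_dist_monotone n f > \<epsilon>" and "card (ones n f) = N" and "N \<ge> 1"
  shows "\<epsilon> / (4 * max 1 (log 2 N)) \<le>
    pmf (do { x \<leftarrow> samp n f; y \<leftarrow> up_neighbour x;
              return_pmf (2 ^ card (zeros x) \<le> N \<and> f y) }) False"
proof -
  define L where "L = max 1 (log 2 (real N))"
  let ?P = "\<lambda>x. 2 ^ card (zeros x) \<le> N"
  let ?F = "\<lambda>x. do { y \<leftarrow> up_neighbour x; return_pmf (?P x \<and> f y) }"
  have ne: "ones n f \<noteq> {}"
    using assms by auto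
  have L: "L \<ge> 1"
    by (simp add: L_def)
  have up: "?P (x[i := True])" if "?P x" for x i
    using that card_mono[OF finite_zeros zeros_update_subset, of x i]
    by (meson le_trans one_le_numeral power_increasing)
  \<comment> \<open>The repair cost at \<open>x\<close> is compared with the chance of exposing a
    defect there. The 4 is 2 changes per violated edge times the 2 in
    \<open>card (zeros x) + 1 \<le> 2 * L\<close>.\<close>
  have "(if ?P x then 2 * real (violations f x) else 1) \<le> 4 * L * pmf (?F x) False"
    if "x \<in> ones n f" for x
  proof -
    have defect: "pmf (?F x) False = (if ?P x then violations f x / (card (zeros x) + 1) else 1)"
      using that by (intro up_neighbour_defect) (simp add: ones_def)
    show ?thesis
    proof (cases "?P x")
      case True
      have "real (2 ^ card (zeros x)) \<le> real N"
        using True by (simp only: of_nat_le_iff)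
      then have "real (card (zeros x)) \<le> log 2 (real N)"
        using assms(3) by (simp add: le_log_iff powr_realpow)
      then have "real (card (zeros x)) + 1 \<le> 2 * L"
        by (simp add: L_def)
      then have "2 * real (violations f x) * (real (card (zeros x)) + 1) \<le>
          2 * real (violations f x) * (2 * L)"
        by (intro mult_left_mono) auto
      then show ?thesis
        unfolding defect using True by (simp add: pos_le_divide_eq mult_ac add_ac)
    next
      case False
      then show ?thesis
        unfolding defect using L by simp
    qed
  qed
  then have "(\<Sum>x\<in>ones n f. if ?P x then 2 * real (violations f x) else 1) \<le>
      (\<Sum>x\<in>ones n f. 4 * L * pmf (?F x) False)"
    by (rule sum_mono)
  also have "\<dots> = 4 * L * (\<Sum>x\<in>ones n f. pmf (?F x) False)"
    by (simp add: sum_distrib_left)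
  finally have "\<epsilon> * N \<le> 4 * L * (\<Sum>x\<in>ones n f. pmf (?F x) False)"
    using rel_dist_bound_by_violations[OF assms(1) ne, of ?P] up assms(2) by simp
  \<comment> \<open>Dividing by \<open>N\<close> turns the sum into the average over a uniform
    sample, that is, the failure probability of one round.\<close>
  then have "\<epsilon> / (4 * L) \<le> (\<Sum>x\<in>ones n f. pmf (?F x) False) / N"
    using L assms(3) by (simp add: divide_simps mult_ac)
  also have "\<dots> = pmf (samp n f \<bind> ?F) False"
    using assms(2) by (simp add: pmf_bind samp_def integral_pmf_of_set[OF ne finite_ones])
  finally show ?thesis
    by (simp add: L_def)
qed

lemma edge_tester_sound:
  assumes "rel_dist_monotone n f > \<epsilon>" and "\<epsilon> > 0" and "card (ones n f) = N" and "N \<ge> 1"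
  shows "accept_prob n (edge_tester N \<epsilon>) f \<le> 1 / 3"
proof -
  define L where "L = max 1 (log 2 (real N))"
  define m where "m = nat \<lfloor>9 * L / \<epsilon>\<rfloor>"
  let ?R = "do { x \<leftarrow> samp n f; y \<leftarrow> up_neighbour x; return_pmf (2 ^ card (zeros x) \<le> N \<and> f y) }"
  have L: "L \<ge> 1"
    by (simp add: L_def)
  have "\<epsilon> < 1"
    using assms(1) rel_dist_monotone_le_1[of n f] by linarith
  then have "1 \<le> L / \<epsilon>"
    using L assms(2) by simp
  \<comment> \<open>Rounding down loses less than 1, which is at most
    \<open>L / \<epsilon>\<close>.\<close>
  then have m: "8 * L / \<epsilon> \<le> m"
    unfolding m_def by linarith
  have "pmf ?R True = 1 - pmf ?R False"
    using pmf_False_conv_True[of ?R] by simp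
  also have "\<dots> \<le> 1 - \<epsilon> / (4 * L)"
    using round_defect[OF assms(1,3,4)] by (simp add: L_def)
  also have "\<dots> \<le> exp (- (\<epsilon> / (4 * L)))"
    using exp_ge_add_one_self[of "- (\<epsilon> / (4 * L))"] by simp
  finally have "pmf ?R True ^ m \<le> exp (- (\<epsilon> / (4 * L))) ^ m"
    by (rule power_mono) simp
  also have "\<dots> = exp (- (m * (\<epsilon> / (4 * L))))"
    by (simp flip: exp_of_nat_mult)
  \<comment> \<open>The exponent is at least \<open>8 * L / \<epsilon>\<close> times
    \<open>\<epsilon> / (4 * L)\<close>, which is 2; then \<open>exp 2 \<ge> 1 + 2\<close> gives the
    bound 1/3.\<close>
  also have "\<dots> \<le> exp (- 2)"
    using mult_right_mono[OF m, of "\<epsilon> / (4 * L)"] L assms(2) by simp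
  also have "\<dots> \<le> 1 / 3"
    using exp_ge_add_one_self[of 2] by (simp add: exp_minus divide_simps)
  finally show ?thesis
    unfolding accept_prob_edge_tester by (simp only: m_def L_def edge_tester_def nonadaptive_alg.simps)
qed

section \<open>Validity and number of the oracle calls\<close>

lemma queries_in_cube_edge_tester: "queries_in_cube n (edge_tester N \<epsilon>)"
proof -
  have "set qs \<subseteq> cube n" if "list_all2 (\<lambda>x y. y \<in> set_pmf (up_neighbour x)) xs qs"
    and "set xs \<subseteq> cube n" for xs qs
    using that by (induction rule: list_all2_induct) (auto simp: set_up_neighbour cube_def)
  then show ?thesis
    by (auto simp: queries_in_cube_def edge_tester_def set_bind_each)
qed

text \<open>Every sample brings exactly one query, which doubles the constant 9.\<close>

lemma calls_edge_tester:
  assumes "\<epsilon> > 0"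
  shows "calls_at_most n N (edge_tester N \<epsilon>) (18 * (max 1 (log 2 N) / \<epsilon>))"
proof -
  define m where "m = num_samples (edge_tester N \<epsilon>)"
  have "real k \<le> 2 * real m" if bk: "(b, k) \<in> set_pmf (run n (edge_tester N \<epsilon>) f)" for b k f
  proof -
    obtain xs qs where xs: "xs \<in> set_pmf (replicate_pmf m (samp n f))"
      and qs: "qs \<in> set_pmf (bind_each up_neighbour xs)" and k: "k = m + length qs"
      using bk by (auto simp: run_edge_tester m_def)
    have "length xs = m"
      using xs by (simp add: set_replicate_pmf)
    moreover have "length qs = length xs"
      using qs by (auto simp: set_bind_each dest: list_all2_lengthD)
    ultimately show ?thesis
      using k by simp
  qed
  \<comment> \<open>Nonnegativity is what lets \<open>nat\<close> of the floor be bounded by the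
    real number itself.\<close>
  moreover have "0 \<le> 9 * max 1 (log 2 N) / \<epsilon>"
    using assms by (simp add: zero_le_divide_iff)
  then have "2 * real m \<le> 18 * (max 1 (log 2 N) / \<epsilon>)"
    unfolding m_def edge_tester_def by simp linarith
  ultimately show ?thesis
    unfolding calls_at_most_def by fastforce
qed

theorem theorem4p3:
  "\<exists>(alg :: nat \<Rightarrow> nat \<Rightarrow> real \<Rightarrow> nonadaptive_alg) (C :: real). C > 0 \<and>
     (\<forall>(n :: nat) (N :: nat) (\<epsilon> :: real). N \<ge> 1 \<and> \<epsilon> > 0 \<longrightarrow>
        queries_in_cube n (alg n N \<epsilon>) \<and>
        monotonicity_tester n N \<epsilon> (alg n N \<epsilon>) \<and>
        one_sided n N (alg n N \<epsilon>) \<and>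
        calls_at_most n N (alg n N \<epsilon>) (C * (max 1 (log 2 (real N)) / \<epsilon>)))"
proof (intro exI[of _ "\<lambda>_. edge_tester"] exI[of _ 18] conjI allI impI)
  fix n N :: nat and \<epsilon> :: real
  assume *: "N \<ge> 1 \<and> \<epsilon> > 0"
  show "monotonicity_tester n N \<epsilon> (edge_tester N \<epsilon>)"
    unfolding monotonicity_tester_def reject_prob_eq
  proof (intro allI impI conjI)
    fix f assume card: "card (ones n f) = N"
    show "2 / 3 \<le> accept_prob n (edge_tester N \<epsilon>) f" if "monotone_bf n f"
      using edge_tester_complete[OF that card, of \<epsilon>] * by simp
    show "2 / 3 \<le> 1 - accept_prob n (edge_tester N \<epsilon>) f" if "\<epsilon> < rel_dist_monotone n f"
      using edge_tester_sound[OF that _ card] * by simp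
  qed
  show "one_sided n N (edge_tester N \<epsilon>)"
    using edge_tester_complete * by (auto simp: one_sided_def)
  show "queries_in_cube n (edge_tester N \<epsilon>)"
    by (rule queries_in_cube_edge_tester)
  show "calls_at_most n N (edge_tester N \<epsilon>) (18 * (max 1 (log 2 (real N)) / \<epsilon>))"
    using * by (intro calls_edge_tester) simp
qed simp

end
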